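(* There exists an absolute constant $C>0$ such that for all integers $t\ge 3$ and $m\ge 4$ with $m\ge 2t$, $$g(m,t)\ \geq\ m^{1-\frac{2t}{\binom{2t}{t}-1}-\frac{C}{\sqrt{\log m}}},$$ and if furthermore $m$ is prime, then $$g(m,t)\ \geq\ m^{1-\frac{2t-1}{\binom{2t}{t}-1}-\frac{C}{\sqrt{\log m}}}.$$ For $t=2$ and every integer $m\ge 64$, $g(m,2)\ge \sqrt{m}/8$.
   Context: Write $\mathbb{Z}_m=\mathbb{Z}/m\mathbb{Z}$. For integers $m,t\ge 2$ with $m\ge 2t$ and a $(2t)$-element subset $X$ of $\mathbb{Z}_m$, let $C(X)=\{\sum_{x\in T}x : T\subset X,\ |T|=t\}\subset\mathbb{Z}_m$ be the set of sums of $t$ distinct elements of $X$ (this set is unrelated to the constant $C$). Then $g(m,t)$ denotes the maximum possible size of a subset $R\subset\mathbb{Z}_m$ such that for every $x_0\in\mathbb{Z}_m$ and every $(2t)$-element subset $X\subset\mathbb{Z}_m$, we have $x_0+C(X)\not\subset R$. Here $\log$ denotes the natural logarithm. *)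

theory Defs
  imports Complex_Main "HOL-Number_Theory.Residues"
begin

text \<open>The group \<open>\<int>/m\<int>\<close> is the additive group of \<open>residue_ring (int m)\<close>, whose elements are the
  canonical representatives \<open>0, \<dots>, m - 1\<close>.\<close>

definition subset_sums :: "nat \<Rightarrow> nat \<Rightarrow> int set \<Rightarrow> int set" where
  "subset_sums m t X =
     {finsum (residue_ring (int m)) (\<lambda>x. x) T |T. T \<subseteq> X \<and> card T = t}"

definition avoiding :: "nat \<Rightarrow> nat \<Rightarrow> int set \<Rightarrow> bool" where
  "avoiding m t R \<longleftrightarrow>
     R \<subseteq> carrier (residue_ring (int m)) \<and>
     (\<forall>x\<^sub>0 \<in> carrier (residue_ring (int m)). \<forall>X \<subseteq> carrier (residue_ring (int m)).
        card X = 2 * t \<longrightarrow>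
        \<not> (\<lambda>c. x\<^sub>0 \<oplus>\<^bsub>residue_ring (int m)\<^esub> c) ` subset_sums m t X \<subseteq> R)"

text \<open>For \<open>m, t \<ge> 2\<close> the maximum is over a finite nonempty set, as the empty set is avoiding.\<close>

definition g :: "nat \<Rightarrow> nat \<Rightarrow> nat" where
  "g m t = Max {card R |R. avoiding m t R}"

end

theory Submission
  imports Defs
begin

text \<open>Write \<open>N = (2t choose t)\<close> and call \<open>x\<^sub>0 + C(X)\<close>, with \<open>card X = 2t\<close>, a configuration. A large set that
  contains no configuration is found by random deletion inside a set that already excludes the
  degenerate configurations, those with fewer than \<open>N\<close> elements.

  Degenerate configurations contain three-term progressions. Suppose that \<open>T \<noteq> U\<close> are \<open>t\<close>-subsets of \<open>X\<close>
  with the same sum \<open>\<sigma>\<close>. Exchange an element \<open>a\<close> of \<open>T - U\<close> for an element \<open>b\<close> of \<open>U - T\<close> in \<open>T\<close>, and do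
  the reverse exchange in \<open>U\<close>. The two new sums are \<open>\<sigma> + (b - a)\<close> and \<open>\<sigma> - (b - a)\<close>, so with \<open>\<sigma>\<close> they
  form a nontrivial progression (\<open>inj_on_sums_of_ap_free\<close>). Hence inside a progression-free set \<open>B\<close>
  every configuration has exactly \<open>N\<close> elements. Behrend's construction gives such a \<open>B\<close> of size
  \<open>m exp (- 8 sqrt (ln m))\<close> in the lower half of \<open>{0..<m}\<close>, where congruences between sums of two
  elements are equations between integers (\<open>behrend\<close>).

  Now keep each element of \<open>B\<close> with probability \<open>p\<close> and delete one element from every surviving
  configuration. If there are at most \<open>m^(k+1) / 2\<close> configurations, some outcome has at least
  \<open>p * card B - p^N * m^(k+1) / 2\<close> elements (\<open>g_ge_deletion\<close>), and \<open>p^(N-1) = card B / m^(k+1)\<close> makes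
  this \<open>p * card B / 2\<close>, which is \<open>m powr (1 - k / (N - 1))\<close> up to a factor \<open>exp (- 17 sqrt (ln m))\<close>
  (\<open>g_lower_bound\<close>). Choosing \<open>x\<^sub>0\<close> and \<open>X\<close> shows that \<open>k = 2t\<close> is always possible. If \<open>m\<close> is prime then
  \<open>x\<^sub>0\<close> can be absorbed into \<open>X\<close>, by translating \<open>X\<close> by \<open>x\<^sub>0 / t\<close>, and \<open>k = 2t - 1\<close> is possible.

  For \<open>t = 2\<close> and \<open>X = {a, b, c, d}\<close> the identity \<open>(a + b) + (c + d) = (a + c) + (b + d)\<close> shows that a Sidon
  set contains no configuration at all. The Sidon set of Erdos and Turan has \<open>p\<close> elements below
  \<open>2 p\<^sup>2\<close> for an odd prime \<open>p\<close>; it fits when \<open>4 p\<^sup>2 \<le> m\<close>. A prime with \<open>sqrt m / 8 \<le> p \<le> sqrt m / 2\<close> is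
  provided by a weak form of Bertrand's postulate, with ratio 4 in place of 2 (\<open>weak_bertrand\<close>).\<close>

section \<open>Configurations\<close>

text \<open>The configuration \<open>x\<^sub>0 + C(X)\<close>, with the sums formed in the integers.\<close>

definition sum_config :: "nat \<Rightarrow> nat \<Rightarrow> int \<Rightarrow> int set \<Rightarrow> int set" where
  "sum_config m t x\<^sub>0 X = (\<lambda>T. (x\<^sub>0 + \<Sum>T) mod int m) ` {T. T \<subseteq> X \<and> card T = t}"

lemma finsum_residue_ring:
  assumes "m > 1" and "T \<subseteq> {0..<int m}"
  shows "finsum (residue_ring (int m)) (\<lambda>x. x) T = \<Sum>T mod int m"
proof -
  interpret residues "int m" "residue_ring (int m)"
    using assms(1) by unfold_locales auto
  have "finite T" using assms(2) by (rule finite_subset) simp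
  then show ?thesis using assms(2)
  proof (induction T rule: finite_induct)
    case empty
    then show ?case by (simp add: res_zero_eq)
  next
    case (insert a T)
    have "finsum (residue_ring (int m)) (\<lambda>x. x) (insert a T)
            = a \<oplus>\<^bsub>residue_ring (int m)\<^esub> finsum (residue_ring (int m)) (\<lambda>x. x) T"
      using insert by (intro finsum_insert) (auto simp: res_carrier_eq)
    also have "\<dots> = (a + \<Sum>T mod int m) mod int m"
      using insert by (simp add: res_add_eq)
    finally show ?case
      using insert by (simp add: mod_add_right_eq)
  qed
qed

text \<open>This removes the algebraic layer: from here on, sums are sums of integers, reduced once at the end.\<close>

lemma avoiding_iff:
  assumes "m > 1"
  shows "avoiding m t R \<longleftrightarrow> R \<subseteq> {0..<int m} \<and>
    (\<forall>x\<^sub>0\<in>{0..<int m}. \<forall>X\<subseteq>{0..<int m}. card X = 2 * t \<longrightarrow> \<not> sum_config m t x\<^sub>0 X \<subseteq> R)"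
proof -
  have carrier: "carrier (residue_ring (int m)) = {0..<int m}"
    by (auto simp: residue_ring_def)
  have "(\<lambda>c. x\<^sub>0 \<oplus>\<^bsub>residue_ring (int m)\<^esub> c) ` subset_sums m t X = sum_config m t x\<^sub>0 X"
    if "X \<subseteq> {0..<int m}" for x\<^sub>0 X
  proof -
    have "subset_sums m t X = (\<lambda>T. finsum (residue_ring (int m)) (\<lambda>x. x) T) ` {T. T \<subseteq> X \<and> card T = t}"
      unfolding subset_sums_def by blast
    also have "\<dots> = (\<lambda>T. \<Sum>T mod int m) ` {T. T \<subseteq> X \<and> card T = t}"
      using that assms by (intro image_cong refl finsum_residue_ring) auto
    finally show ?thesis
      by (simp add: sum_config_def image_image residue_ring_def mod_add_right_eq)
  qed
  then show ?thesis
    unfolding avoiding_def carrier by auto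
qed

lemma g_ge_card:
  assumes "avoiding m t R"
  shows "card R \<le> g m t"
proof -
  have "{card R |R. avoiding m t R} \<subseteq> card ` Pow (carrier (residue_ring (int m)))"
    by (auto simp: avoiding_def)
  moreover have "finite (carrier (residue_ring (int m)))"
    by (simp add: residue_ring_def)
  ultimately have "finite {card R |R. avoiding m t R}"
    by (meson finite_imageI finite_Pow_iff finite_subset)
  then show ?thesis
    unfolding g_def using assms by (intro Max_ge) auto
qed

definition configs :: "nat \<Rightarrow> nat \<Rightarrow> int set set" where
  "configs m t = (\<Union>x\<^sub>0\<in>{0..<int m}. sum_config m t x\<^sub>0 ` {X. X \<subseteq> {0..<int m} \<and> card X = 2 * t})"

lemma configs_iff:
  "E \<in> configs m t \<longleftrightarrow>
     (\<exists>x\<^sub>0\<in>{0..<int m}. \<exists>X\<subseteq>{0..<int m}. card X = 2 * t \<and> E = sum_config m t x\<^sub>0 X)"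
  unfolding configs_def by blast

lemma finite_subsets_of_card: "finite A \<Longrightarrow> finite {X. X \<subseteq> A \<and> card X = k}"
  by (rule finite_subset[of _ "Pow A"]) auto

lemma finite_configs: "finite (configs m t)"
  unfolding configs_def by (intro finite_UN_I finite_imageI finite_subsets_of_card) simp_all

text \<open>The number of configurations has to be at most half of a power of \<open>m\<close> so that deletion costs at most
  half of the surviving elements; the factor 2 comes from \<open>k! \<ge> 2\<close>.\<close>

lemma two_times_choose_le:
  assumes "2 \<le> k" shows "2 * (m choose k) \<le> m ^ k"
proof -
  have "2 \<le> (fact k :: nat)"
    using assms fact_mono_nat[of 2 k] by (simp add: fact_2)
  then have "2 * (m choose k) \<le> (m choose k) * fact k" by simp
  also have "\<dots> \<le> m ^ k" by (rule binomial_fact_pow)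
  finally show ?thesis .
qed

lemma card_configs_le:
  assumes "1 \<le> t"
  shows "2 * card (configs m t) \<le> m ^ (2 * t + 1)"
proof -
  let ?\<X> = "{X. X \<subseteq> {0..<int m} \<and> card X = 2 * t}"
  have "card (configs m t) \<le> (\<Sum>x\<^sub>0\<in>{0..<int m}. card (sum_config m t x\<^sub>0 ` ?\<X>))"
    unfolding configs_def by (intro card_UN_le) simp
  also have "\<dots> \<le> (\<Sum>x\<^sub>0\<in>{0..<int m}. card ?\<X>)"
    by (intro sum_mono card_image_le finite_subsets_of_card) simp
  also have "\<dots> = m * (m choose (2 * t))" by (simp add: n_subsets)
  finally have "2 * card (configs m t) \<le> m * (2 * (m choose (2 * t)))" by simp
  also have "\<dots> \<le> m * m ^ (2 * t)" using assms by (intro mult_left_mono two_times_choose_le) auto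
  finally show ?thesis by simp
qed

text \<open>Adding \<open>z\<close> to every element of \<open>X\<close> adds \<open>t z\<close> to every sum of \<open>t\<close> elements. For prime \<open>m > t\<close> the
  equation \<open>t z = x\<^sub>0\<close> is solvable modulo \<open>m\<close>, so the shift \<open>x\<^sub>0\<close> gives no configurations beyond those
  with shift zero. This saves one power of \<open>m\<close> in the count.\<close>

lemma sum_config_translate:
  assumes "prime m" and "0 < t" and "t < m" and X: "X \<subseteq> {0..<int m}"
  obtains Y where "Y \<subseteq> {0..<int m}" "card Y = card X" "sum_config m t x\<^sub>0 X = sum_config m t 0 Y"
proof -
  have m: "m > 1" using assms(1) prime_gt_1_nat by blast
  have "coprime (int t) (int m)"
    using assms prime_nat_iff by (metis coprime_commute coprime_int_iff nat_dvd_not_less prime_imp_coprime)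
  (* z is x0 / t modulo m. *)
  then obtain z where z: "[int t * z = x\<^sub>0] (mod int m)"
    using cong_solve_coprime_int[of "int t" "int m"]
    by (metis cong_scalar_right mult.assoc mult_1)
  define f where "f x = (x + z) mod int m" for x
  have inj: "inj_on f X"
  proof (rule inj_onI)
    fix x y assume "x \<in> X" "y \<in> X" "f x = f y"
    then have "[x + z = y + z] (mod int m)" by (simp add: f_def cong_def)
    then have "[x = y] (mod int m)" by (simp add: cong_add_rcancel)
    moreover have "x \<in> {0..<int m}" "y \<in> {0..<int m}" using X \<open>x \<in> X\<close> \<open>y \<in> X\<close> by blast+
    ultimately show "x = y" by (simp add: cong_def)
  qed
  have sums: "(0 + \<Sum>(f ` T)) mod int m = (x\<^sub>0 + \<Sum>T) mod int m" if "T \<subseteq> X" "card T = t" for T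
  proof -
    have "[\<Sum>(f ` T) = (\<Sum>x\<in>T. x + z)] (mod int m)"
      unfolding sum.reindex[OF inj_on_subset[OF inj that(1)]]
      by (intro cong_sum) (simp add: f_def cong_def)
    also have "(\<Sum>x\<in>T. x + z) = int t * z + \<Sum>T"
      using that by (simp add: sum.distrib)
    also have "[\<dots> = x\<^sub>0 + \<Sum>T] (mod int m)"
      using z by (simp add: cong_add_rcancel)
    finally show ?thesis by (simp add: cong_def)
  qed
  have subsets: "{S. S \<subseteq> f ` X \<and> card S = t} = (`) f ` {T. T \<subseteq> X \<and> card T = t}"
  proof -
    have "card (f ` T) = card T" if "T \<subseteq> X" for T
      using card_image inj_on_subset[OF inj that] by blast
    then show ?thesis by (auto simp: subset_image_iff)
  qed
  have "sum_config m t 0 (f ` X) = sum_config m t x\<^sub>0 X"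
    unfolding sum_config_def subsets image_image
    by (intro image_cong refl) (use sums in auto)
  moreover have "f ` X \<subseteq> {0..<int m}" using m by (auto simp: f_def)
  ultimately show thesis using that[of "f ` X"] card_image[OF inj] by metis
qed

lemma card_configs_prime_le:
  assumes "prime m" "1 \<le> t" "t < m"
  shows "2 * card (configs m t) \<le> m ^ (2 * t)"
proof -
  have "configs m t \<subseteq> sum_config m t 0 ` {X. X \<subseteq> {0..<int m} \<and> card X = 2 * t}"
  proof
    fix E assume "E \<in> configs m t"
    then obtain x\<^sub>0 X where E: "E = sum_config m t x\<^sub>0 X" "X \<subseteq> {0..<int m}" "card X = 2 * t"
      unfolding configs_iff by blast
    obtain Y where "Y \<subseteq> {0..<int m}" "card Y = card X" "sum_config m t x\<^sub>0 X = sum_config m t 0 Y"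
      using sum_config_translate[OF assms(1) _ assms(3) E(2)] assms(2) by (metis less_eq_Suc_le One_nat_def)
    then show "E \<in> sum_config m t 0 ` {X. X \<subseteq> {0..<int m} \<and> card X = 2 * t}"
      using E by auto
  qed
  then have "card (configs m t) \<le> card {X. X \<subseteq> {0..<int m} \<and> card X = 2 * t}"
    by (intro surj_card_le finite_subsets_of_card) simp
  also have "\<dots> = m choose (2 * t)" by (simp add: n_subsets)
  finally have "2 * card (configs m t) \<le> 2 * (m choose (2 * t))" by simp
  also have "\<dots> \<le> m ^ (2 * t)" using assms by (intro two_times_choose_le) auto
  finally show ?thesis .
qed

section \<open>Degenerate configurations and three-term progressions\<close>

text \<open>The equation is one in the integers. Together with the restriction to \<open>2 * x < m\<close> it excludes
  progressions modulo \<open>m\<close> as well, by the next lemma.\<close>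

definition ap_free :: "int set \<Rightarrow> bool" where
  "ap_free B \<longleftrightarrow> (\<forall>x\<in>B. \<forall>y\<in>B. \<forall>z\<in>B. x + z = 2 * y \<longrightarrow> x = y)"

lemma half_interval_sums_eq:
  fixes a b c d m :: int
  assumes "2 * a < m" "2 * b < m" "2 * c < m" "2 * d < m"
      and "0 \<le> a" "0 \<le> b" "0 \<le> c" "0 \<le> d"
      and "(a + b) mod m = (c + d) mod m"
  shows "a + b = c + d"
  using assms by (simp add: mod_pos_pos_trivial)

text \<open>If \<open>T\<close> and \<open>U\<close> have equal sums, then exchanging \<open>a \<in> T - U\<close> and \<open>b \<in> U - T\<close> between them moves their
  sums by \<open>b - a\<close> in opposite directions. The common sum is therefore the middle term of a progression
  in \<open>B\<close> whose difference \<open>b - a\<close> is nonzero.\<close>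

lemma inj_on_sums_of_ap_free:
  assumes m: "m > 1" and X: "X \<subseteq> {0..<int m}"
    and B: "B \<subseteq> {0..<int m}" "\<And>x. x \<in> B \<Longrightarrow> 2 * x < int m" "ap_free B"
    and sub: "sum_config m t x\<^sub>0 X \<subseteq> B"
  shows "inj_on (\<lambda>T. (x\<^sub>0 + \<Sum>T) mod int m) {T. T \<subseteq> X \<and> card T = t}"
proof (rule inj_onI, rule ccontr)
  let ?s = "\<lambda>T. (x\<^sub>0 + \<Sum>T) mod int m"
  fix T U assume T: "T \<in> {T. T \<subseteq> X \<and> card T = t}" and U: "U \<in> {T. T \<subseteq> X \<and> card T = t}"
    and eq: "?s T = ?s U" and "T \<noteq> U"
  have fin: "finite T" "finite U" using T U X by (auto intro: finite_subset)
  obtain a where a: "a \<in> T" "a \<notin> U"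
    using \<open>T \<noteq> U\<close> T U fin card_subset_eq[of U T] by auto
  obtain b where b: "b \<in> U" "b \<notin> T"
    using \<open>T \<noteq> U\<close> T U fin card_subset_eq[of T U] by auto
  define V where "V = insert b (T - {a})"
  define W where "W = insert a (U - {b})"
  have sumV: "\<Sum>V = \<Sum>T + b - a" and sumW: "\<Sum>W = \<Sum>U + a - b"
    using a b fin by (simp_all add: V_def W_def sum_diff1)
  have card: "card V = t" "card W = t"
  proof -
    have "0 < t" using T a fin card_gt_0_iff by blast
    then show "card V = t" "card W = t" 
      using a b fin T U by (simp_all add: V_def W_def card_Diff_singleton)
  qed
  have VX: "V \<subseteq> X" "W \<subseteq> X" using T U a b by (auto simp: V_def W_def)
  have mem: "?s S \<in> B" if "S \<subseteq> X" "card S = t" for S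
    using sub that by (auto simp: sum_config_def)
  have "(?s V + ?s W) mod int m = (x\<^sub>0 + \<Sum>V + (x\<^sub>0 + \<Sum>W)) mod int m"
    by (simp add: mod_add_eq)
  also have "\<dots> = (x\<^sub>0 + \<Sum>T + (x\<^sub>0 + \<Sum>U)) mod int m"
    by (simp add: sumV sumW)
  also have "\<dots> = (?s T + ?s U) mod int m"
    by (simp add: mod_add_eq)
  finally have "(?s V + ?s W) mod int m = (?s T + ?s T) mod int m"
    using eq by simp
  then have "?s V + ?s W = ?s T + ?s T"
    using mem[OF VX(1) card(1)] mem[OF VX(2) card(2)] mem[of T] T B m
    by (intro half_interval_sums_eq[of _ "int m"]) auto
  then have "?s V = ?s T"
    using B(3) mem[OF VX(1) card(1)] mem[OF VX(2) card(2)] mem[of T] T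
    unfolding ap_free_def by auto
  then have "int m dvd b - a"
    unfolding mod_eq_dvd_iff by (simp add: sumV)
  then have "a mod int m = b mod int m"
    by (metis mod_eq_dvd_iff)
  moreover have "a \<in> {0..<int m}" "b \<in> {0..<int m}"
    using a b T U X by blast+
  ultimately have "a = b" by simp
  then show False using a b by simp
qed

section \<open>The deletion method\<close>

text \<open>The probability that a \<open>p\<close>-random subset of \<open>B\<close> contains \<open>E\<close>. Expanding
  \<open>\<Prod>x\<in>B. (p + q x)\<close> over subsets, with \<open>q\<close> equal to 0 on \<open>E\<close> and to \<open>1 - p\<close> elsewhere, retains
  exactly the terms of the supersets of \<open>E\<close>.\<close>

lemma sum_binomial_weights_superset:
  fixes p :: real
  assumes "finite B" "E \<subseteq> B"
  shows "(\<Sum>S\<in>Pow B. p ^ card S * (1 - p) ^ card (B - S) * of_bool (E \<subseteq> S)) = p ^ card E"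
proof -
  have "(\<Prod>x\<in>S. p) * (\<Prod>x\<in>B - S. if x \<in> E then 0 else 1 - p)
      = p ^ card S * (1 - p) ^ card (B - S) * of_bool (E \<subseteq> S)" if "S \<subseteq> B" for S
  proof (cases "E \<subseteq> S")
    case True
    then have "(\<Prod>x\<in>B - S. if x \<in> E then 0 else 1 - p) = (\<Prod>x\<in>B - S. 1 - p)"
      by (intro prod.cong) auto
    then show ?thesis using True by simp
  next
    case False
    then have "\<exists>x\<in>B - S. x \<in> E" using assms by blast
    then have "(\<Prod>x\<in>B - S. if x \<in> E then 0 else 1 - p) = 0"
      using assms(1) by (auto intro!: prod_zero)
    then show ?thesis using False by simp
  qed
  note weight = this
  have "(\<Sum>S\<in>Pow B. p ^ card S * (1 - p) ^ card (B - S) * of_bool (E \<subseteq> S))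
      = (\<Sum>S\<in>Pow B. (\<Prod>x\<in>S. p) * (\<Prod>x\<in>B - S. if x \<in> E then 0 else 1 - p))"
    by (intro sum.cong refl weight[symmetric]) auto
  also have "\<dots> = (\<Prod>x\<in>B. p + (if x \<in> E then 0 else 1 - p))"
    using prod_add[OF assms(1), of "\<lambda>_. p" "\<lambda>x. if x \<in> E then 0 else 1 - p"] by simp
  also have "\<dots> = (\<Prod>x\<in>B. if x \<in> E then p else 1)"
    by (intro prod.cong) auto
  also have "\<dots> = p ^ card E"
    using assms by (simp add: prod.If_cases Int_absorb1)
  finally show ?thesis .
qed

text \<open>The expected number of elements of a \<open>p\<close>-random subset minus the expected number of members of \<open>F\<close>
  inside it is \<open>p * card B - p ^ N * card F\<close>. Some subset does at least as well as the average, and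
  deleting one element from each member of \<open>F\<close> inside it yields \<open>R\<close>.\<close>

lemma independent_set_by_deletion:
  fixes p :: real
  assumes "finite B" "finite F" "0 < N" "0 \<le> p" "p \<le> 1"
    and F: "\<And>E. E \<in> F \<Longrightarrow> E \<subseteq> B \<and> card E = N"
  obtains R where "R \<subseteq> B" "\<And>E. E \<in> F \<Longrightarrow> \<not> E \<subseteq> R"
    "p * card B - p ^ N * card F \<le> card R"
proof -
  define w where "w S = p ^ card S * (1 - p) ^ card (B - S)" for S
  define gain where "gain S = real (card S) - real (card {E\<in>F. E \<subseteq> S})" for S
  define v where "v = p * card B - p ^ N * card F"
  have w_nonneg: "0 \<le> w S" for S using assms by (simp add: w_def)
  have w_total: "(\<Sum>S\<in>Pow B. w S) = 1"
    using sum_binomial_weights_superset[of B "{}" p] assms(1) by (simp add: w_def)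
  have w_card: "(\<Sum>S\<in>Pow B. w S * card S) = p * card B"
  proof -
    have "(\<Sum>S\<in>Pow B. w S * card S) = (\<Sum>S\<in>Pow B. \<Sum>x\<in>B. w S * of_bool ({x} \<subseteq> S))"
      by (intro sum.cong refl)
        (auto simp: assms(1) Int_absorb1 simp flip: sum_distrib_left)
    also have "\<dots> = (\<Sum>x\<in>B. \<Sum>S\<in>Pow B. w S * of_bool ({x} \<subseteq> S))"
      by (rule sum.swap)
    also have "\<dots> = (\<Sum>x\<in>B. p)"
      unfolding w_def using assms(1) by (intro sum.cong refl) (subst sum_binomial_weights_superset; simp)
    finally show ?thesis by simp
  qed
  have w_edges: "(\<Sum>S\<in>Pow B. w S * card {E\<in>F. E \<subseteq> S}) = p ^ N * card F"
  proof -
    have "(\<Sum>S\<in>Pow B. w S * card {E\<in>F. E \<subseteq> S}) = (\<Sum>S\<in>Pow B. \<Sum>E\<in>F. w S * of_bool (E \<subseteq> S))"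
      by (intro sum.cong refl) (simp add: sum_distrib_left[symmetric] assms(2) Int_def)
    also have "\<dots> = (\<Sum>E\<in>F. \<Sum>S\<in>Pow B. w S * of_bool (E \<subseteq> S))"
      by (rule sum.swap)
    also have "\<dots> = (\<Sum>E\<in>F. p ^ N)"
      unfolding w_def using assms(1) F by (intro sum.cong refl) (subst sum_binomial_weights_superset; simp)
    finally show ?thesis by simp
  qed
  have "\<exists>S\<in>Pow B. v \<le> gain S"
  proof (rule ccontr)
    assume "\<not> ?thesis"
    then have less: "gain S < v" if "S \<in> Pow B" for S
      using that by (meson not_le)
    have pos: "\<exists>S\<in>Pow B. 0 < w S"
    proof (rule ccontr)
      assume "\<not> ?thesis"
      then have "(\<Sum>S\<in>Pow B. w S) \<le> 0" by (intro sum_nonpos) (meson not_le)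
      then show False using w_total by simp
    qed
    have "(\<Sum>S\<in>Pow B. w S * gain S) < (\<Sum>S\<in>Pow B. w S * v)"
    proof (rule sum_strict_mono_ex1)
      show "\<forall>S\<in>Pow B. w S * gain S \<le> w S * v"
        using w_nonneg less by (meson mult_left_mono less_imp_le)
      show "\<exists>S\<in>Pow B. w S * gain S < w S * v"
        using pos less by (meson mult_strict_left_mono)
    qed (use assms(1) in simp)
    also have "\<dots> = v" using w_total by (simp flip: sum_distrib_right)
    also have "(\<Sum>S\<in>Pow B. w S * gain S) = v"
      using w_card w_edges by (simp add: gain_def v_def right_diff_distrib sum_subtractf)
    finally show False by simp
  qed
  then obtain S where S: "S \<subseteq> B" "v \<le> gain S" by auto
  define D where "D = {E\<in>F. E \<subseteq> S}"
  (* h picks the element to delete from each surviving member of F. *)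
  define h where "h E = (SOME x. x \<in> E)" for E :: "'a set"
  have h: "h E \<in> E" if "E \<in> F" for E
    using F[OF that] assms(3) unfolding h_def by (metis card.empty less_irrefl some_in_eq)
  have finS: "finite S" using S assms(1) finite_subset by blast
  have "card S - card D \<le> card (S - h ` D)"
  proof -
    have "card S - card (h ` D) \<le> card (S - h ` D)"
      using assms(2) by (intro diff_card_le_card_Diff) (simp add: D_def)
    moreover have "card (h ` D) \<le> card D"
      using assms(2) by (intro card_image_le) (simp add: D_def)
    ultimately show ?thesis by linarith
  qed
  then have "gain S \<le> card (S - h ` D)" by (simp add: gain_def D_def)
  show thesis
  proof (rule that[of "S - h ` D"])
    show "S - h ` D \<subseteq> B" using S by blast
    show "\<not> E \<subseteq> S - h ` D" if "E \<in> F" for E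
      using h[OF that] that unfolding D_def by blast
    show "p * card B - p ^ N * card F \<le> card (S - h ` D)"
      using S \<open>gain S \<le> _\<close> unfolding v_def by linarith
  qed
qed

text \<open>Inside a progression-free \<open>B\<close> the configurations form a family of sets of equal size, as deletion
  requires; the configurations that leave \<open>B\<close> are harmless.\<close>

lemma g_ge_deletion:
  fixes p :: real
  assumes m: "m > 1" and t: "1 \<le> t" and p: "0 \<le> p" "p \<le> 1"
    and B: "B \<subseteq> {0..<int m}" "\<And>x. x \<in> B \<Longrightarrow> 2 * x < int m" "ap_free B"
  shows "p * card B - p ^ (2 * t choose t) * card (configs m t) \<le> g m t"
proof -
  define F where "F = {E \<in> configs m t. E \<subseteq> B}"
  have uniform: "E \<subseteq> B \<and> card E = 2 * t choose t" if EF: "E \<in> F" for E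
  proof -
    obtain x\<^sub>0 X where E: "E = sum_config m t x\<^sub>0 X" "X \<subseteq> {0..<int m}" "card X = 2 * t" "E \<subseteq> B"
      using EF unfolding F_def configs_iff by blast
    have "finite X" using E(2) by (rule finite_subset) simp
    moreover have "card E = card {T. T \<subseteq> X \<and> card T = t}"
      using inj_on_sums_of_ap_free[OF m E(2) B] E(1,4) unfolding sum_config_def
      by (metis (no_types, lifting) card_image)
    ultimately show ?thesis using E by (simp add: n_subsets)
  qed
  have finF: "finite F" unfolding F_def using finite_configs by simp
  have finB: "finite B" using B(1) by (rule finite_subset) simp
  obtain R where R: "R \<subseteq> B" "\<And>E. E \<in> F \<Longrightarrow> \<not> E \<subseteq> R"
      "p * card B - p ^ (2 * t choose t) * card F \<le> card R"
    using independent_set_by_deletion[OF finB finF, of "2 * t choose t" p] p uniform by auto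
  have "avoiding m t R"
    unfolding avoiding_iff[OF m]
  proof (intro conjI ballI allI impI notI)
    fix x\<^sub>0 X assume "x\<^sub>0 \<in> {0..<int m}" "X \<subseteq> {0..<int m}" "card X = 2 * t" "sum_config m t x\<^sub>0 X \<subseteq> R"
    then have "sum_config m t x\<^sub>0 X \<in> F" using R(1) unfolding F_def configs_iff by blast
    then show False using R(2) \<open>sum_config m t x\<^sub>0 X \<subseteq> R\<close> by blast
  qed (use R(1) B(1) in auto)
  then have "real (card R) \<le> g m t" using g_ge_card by simp
  moreover have "p ^ (2 * t choose t) * card F \<le> p ^ (2 * t choose t) * card (configs m t)"
    using p finite_configs by (intro mult_left_mono) (auto intro!: card_mono simp: F_def)
  ultimately show ?thesis using R(3) by linarith
qed

section \<open>Behrend's progression-free sets\<close>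

lemma digit_sum_bounds:
  fixes b :: int
  assumes "\<And>i. i < d \<Longrightarrow> 0 \<le> x i \<and> x i < b" "0 < b"
  shows "0 \<le> (\<Sum>i<d. x i * b ^ i) \<and> (\<Sum>i<d. x i * b ^ i) < b ^ d"
  using assms(1)
proof (induction d)
  case (Suc d)
  have "0 \<le> x d" "x d + 1 \<le> b" using Suc.prems[of d] by auto
  then have "(x d + 1) * b ^ d \<le> b * b ^ d" "0 \<le> x d * b ^ d"
    using assms(2) by (auto intro!: mult_right_mono)
  moreover have "0 \<le> (\<Sum>i<d. x i * b ^ i) \<and> (\<Sum>i<d. x i * b ^ i) < b ^ d"
    using Suc by simp
  ultimately show ?case by (simp add: distrib_right)
qed simp

text \<open>The top digit is the quotient by \<open>b ^ d\<close>, so the digits are recovered one at a time.\<close>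

lemma digits_unique:
  fixes b :: int
  assumes "\<And>i. i < d \<Longrightarrow> 0 \<le> x i \<and> x i < b" "\<And>i. i < d \<Longrightarrow> 0 \<le> y i \<and> y i < b" "0 < b"
    and "(\<Sum>i<d. x i * b ^ i) = (\<Sum>i<d. y i * b ^ i)" and "i < d"
  shows "x i = y i"
  using assms(1,2,4,5)
proof (induction d)
  case (Suc d)
  let ?X = "\<Sum>i<d. x i * b ^ i" and ?Y = "\<Sum>i<d. y i * b ^ i"
  have quotient: "(z * b ^ d + r) div b ^ d = z" if "0 \<le> r" "r < b ^ d" for z r
    using that assms(3) by simp
  have "?X + x d * b ^ d = ?Y + y d * b ^ d" using Suc.prems(3) by simp
  then have top: "x d = y d"
    using quotient[of ?X "x d"] quotient[of ?Y "y d"] digit_sum_bounds[of d x b] digit_sum_bounds[of d y b]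
      Suc.prems(1,2) assms(3) by (simp add: add.commute)
  then have "?X = ?Y" using Suc.prems(3) by simp
  then have "x i = y i" if "i < d" using Suc that by auto
  then show ?case using top Suc.prems(4) less_antisym by blast
qed simp

text \<open>A sphere contains no midpoint of two of its other points, by the parallelogram law
  \<open>|x - z|\<^sup>2 = 2 |x|\<^sup>2 + 2 |z|\<^sup>2 - |x + z|\<^sup>2\<close>.\<close>

lemma parallelogram_digits:
  fixes x y z :: "nat \<Rightarrow> int"
  assumes "\<And>i. i < d \<Longrightarrow> x i + z i = 2 * y i"
    and "(\<Sum>i<d. (x i)\<^sup>2) = s" "(\<Sum>i<d. (y i)\<^sup>2) = s" "(\<Sum>i<d. (z i)\<^sup>2) = s"
    and "i < d"
  shows "x i = y i"
proof -
  have "(\<Sum>i<d. (x i - z i)\<^sup>2) = (\<Sum>i<d. 2 * (x i)\<^sup>2 + 2 * (z i)\<^sup>2 - (2 * y i)\<^sup>2)"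
  proof (intro sum.cong refl)
    fix i assume "i \<in> {..<d}"
    then show "(x i - z i)\<^sup>2 = 2 * (x i)\<^sup>2 + 2 * (z i)\<^sup>2 - (2 * y i)\<^sup>2"
      using assms(1)[of i, symmetric] by (simp add: power2_eq_square algebra_simps)
  qed
  also have "\<dots> = 2 * (\<Sum>i<d. (x i)\<^sup>2) + 2 * (\<Sum>i<d. (z i)\<^sup>2) - 4 * (\<Sum>i<d. (y i)\<^sup>2)"
    by (simp add: sum.distrib sum_subtractf sum_distrib_left power_mult_distrib)
  also have "\<dots> = 0" using assms by simp
  finally have "(x i - z i)\<^sup>2 = 0"
    using assms(5) by (simp add: sum_nonneg_eq_0_iff)
  then show ?thesis using assms(1)[OF assms(5)] by simp
qed

text \<open>Read the points of the cube \<open>{0..<n} ^ d\<close> as digit strings in base \<open>2 n\<close>. Digits below \<open>n\<close> add without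
  carries, so an additive relation \<open>r + r'' = 2 r'\<close> between the numbers holds digit by digit, hence
  between the points. On a sphere this forces equality. Since \<open>|x|\<^sup>2\<close> takes fewer than \<open>d n\<^sup>2\<close> values on
  the cube, one of the spheres contains at least the fraction \<open>1 / (d n\<^sup>2)\<close> of it.\<close>

lemma behrend_sphere:
  fixes n :: int
  assumes "0 < d" "0 < n"
  obtains B where "B \<subseteq> {0..<(2 * n) ^ d}" "ap_free B" "n ^ d \<le> int (card B) * (int d * n\<^sup>2)"
proof -
  define V where "V = ({..<d} \<rightarrow>\<^sub>E {0..<n})"
  define q where "q x = (\<Sum>i<d. (x i)\<^sup>2)" for x :: "nat \<Rightarrow> int"
  define e where "e x = (\<Sum>i<d. x i * (2 * n) ^ i)" for x :: "nat \<Rightarrow> int"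
  define fib where "fib s = {x\<in>V. q x = s}" for s
  have cardV: "int (card V) = n ^ d" using assms by (simp add: V_def card_PiE)
  have V: "0 \<le> x i \<and> x i < n" if "x \<in> V" "i < d" for x i
    using PiE_mem[of x "{..<d}" "\<lambda>_. {0..<n}" i] that by (simp add: V_def)
  have q: "q x \<in> {0..<int d * n\<^sup>2}" if "x \<in> V" for x
  proof -
    have "q x < (\<Sum>i<d. n\<^sup>2)" unfolding q_def
      using V[OF that] assms by (intro sum_strict_mono) (auto intro!: power_strict_mono)
    then show ?thesis by (auto simp: q_def intro!: sum_nonneg)
  qed
  have "\<exists>s. n ^ d \<le> int (card (fib s)) * (int d * n\<^sup>2)"
  proof (rule ccontr)
    assume "\<not> ?thesis"
    then have less: "int (card (fib s)) * (int d * n\<^sup>2) < n ^ d" for s by (meson not_le)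
    have "V = (\<Union>s\<in>{0..<int d * n\<^sup>2}. fib s)" using q by (auto simp: fib_def)
    then have "card V \<le> (\<Sum>s\<in>{0..<int d * n\<^sup>2}. card (fib s))"
      by (metis card_UN_le finite_atLeastLessThan_int)
    then have "n ^ d * (int d * n\<^sup>2) \<le> (\<Sum>s\<in>{0..<int d * n\<^sup>2}. int (card (fib s)) * (int d * n\<^sup>2))"
      using assms cardV by (simp flip: sum_distrib_right of_nat_sum)
    also have "\<dots> < (\<Sum>s\<in>{0..<int d * n\<^sup>2}. n ^ d)"
      using less assms by (intro sum_strict_mono) auto
    also have "\<dots> = n ^ d * (int d * n\<^sup>2)" by simp
    finally show False by simp
  qed
  then obtain s where s: "n ^ d \<le> int (card (fib s)) * (int d * n\<^sup>2)" ..
  have ext: "x = y" if "x \<in> V" "y \<in> V" "\<And>i. i < d \<Longrightarrow> x i = y i" for x y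
    using that unfolding V_def by (intro PiE_ext) auto
  have inj: "inj_on e (fib s)"
  proof (rule inj_onI)
    fix x y assume xy: "x \<in> fib s" "y \<in> fib s" "e x = e y"
    then have in_V: "x \<in> V" "y \<in> V" by (auto simp: fib_def)
    show "x = y"
      using xy V[OF in_V(1)] V[OF in_V(2)] assms
      by (intro ext[OF in_V] digits_unique[of d x "2 * n" y]) (fastforce simp: e_def)+
  qed
  show thesis
  proof (rule that[of "e ` fib s"])
    show "e ` fib s \<subseteq> {0..<(2 * n) ^ d}"
    proof
      fix r assume "r \<in> e ` fib s"
      then obtain x where x: "x \<in> V" "r = e x" by (auto simp: fib_def)
      then show "r \<in> {0..<(2 * n) ^ d}"
        using digit_sum_bounds[of d x "2 * n"] V[OF x(1)] assms by (fastforce simp: e_def)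
    qed
    show "n ^ d \<le> int (card (e ` fib s)) * (int d * n\<^sup>2)"
      using s by (simp add: card_image[OF inj])
    show "ap_free (e ` fib s)"
      unfolding ap_free_def
    proof (intro ballI impI)
      fix r r' r'' assume "r \<in> e ` fib s" "r' \<in> e ` fib s" "r'' \<in> e ` fib s" and eq: "r + r'' = 2 * r'"
      then obtain x y z where xyz: "x \<in> fib s" "y \<in> fib s" "z \<in> fib s"
        and r: "r = e x" "r' = e y" "r'' = e z" by blast
      then have in_V: "x \<in> V" "y \<in> V" "z \<in> V" by (auto simp: fib_def)
      have "e (\<lambda>i. x i + z i) = e (\<lambda>i. 2 * y i)"
        using eq by (simp add: r e_def sum.distrib distrib_right sum_distrib_left mult.assoc)
      then have "x i + z i = 2 * y i" if "i < d" for i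
        using V[OF in_V(1)] V[OF in_V(2)] V[OF in_V(3)] assms that
        by (intro digits_unique[of d "\<lambda>i. x i + z i" "2 * n" "\<lambda>i. 2 * y i"]) (fastforce simp: e_def)+
      then have "x = y"
        using parallelogram_digits[of d x z y s] xyz
        by (intro ext in_V) (auto simp: fib_def q_def)
      then show "r = r'" by (simp add: r)
    qed
  qed
qed

text \<open>Dimension \<open>d\<close> and digits below \<open>2 ^ (d - 1)\<close> lead to numbers below \<open>2 ^ d\<^sup>2\<close>, so \<open>d\<close> is about
  \<open>sqrt (log 2 m)\<close>. Both the sphere count and the rounding of \<open>m\<close> cost a factor \<open>2 ^ O(d)\<close>, which is
  \<open>exp (O (sqrt (ln m)))\<close>.\<close>

lemma behrend:
  assumes "m \<ge> 4"
  obtains B where "B \<subseteq> {0..<int m}" "\<And>x. x \<in> B \<Longrightarrow> 2 * x < int m" "ap_free B"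
    "real m * exp (- 8 * sqrt (ln (real m))) \<le> real (card B)"
proof -
  define P where "P d \<longleftrightarrow> 2 ^ (d\<^sup>2 + 1) \<le> m" for d
  have bound: "d \<le> m" if "P d" for d
  proof -
    have "d < 2 ^ d" by simp
    also have "(2::nat) ^ d \<le> 2 ^ (d\<^sup>2 + 1)"
      by (intro power_increasing) (auto simp: power2_eq_square intro: le_SucI le_square)
    finally show ?thesis using that unfolding P_def by linarith
  qed
  have "P 1" using assms by (simp add: P_def)
  define d where "d = (GREATEST d. P d)"
  have "P d" unfolding d_def using \<open>P 1\<close> bound by (rule GreatestI_nat)
  have "1 \<le> d" unfolding d_def using \<open>P 1\<close> bound by (rule Greatest_le_nat)
  have "\<not> P (d + 1)"
    using Greatest_le_nat[of P "d + 1" m] bound unfolding d_def by fastforce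
  then have upper: "m \<le> 2 ^ ((d + 1)\<^sup>2 + 1)" by (simp add: P_def)
  define n :: int where "n = 2 ^ (d - 1)"
  have two_n: "2 * n = 2 ^ d" using \<open>1 \<le> d\<close> by (simp add: n_def flip: power_Suc)
  obtain B where B: "B \<subseteq> {0..<(2 * n) ^ d}" "ap_free B" "n ^ d \<le> int (card B) * (int d * n\<^sup>2)"
    using behrend_sphere[of d n] \<open>1 \<le> d\<close> by (auto simp: n_def)
  have "(2 * n) ^ d = 2 ^ d\<^sup>2" by (simp add: two_n power2_eq_square power_mult)
  moreover have "2 * 2 ^ d\<^sup>2 \<le> int m"
    using \<open>P d\<close> unfolding P_def by (metis Suc_eq_plus1 of_nat_le_iff of_nat_numeral of_nat_power power_Suc)
  ultimately have half: "2 * x < int m" if "x \<in> B" for x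
    using B(1) that by fastforce
  have "(2::nat) ^ d\<^sup>2 \<le> card B * 2 ^ (4 * d)"
  proof -
    have "2 ^ d\<^sup>2 = n ^ d * 2 ^ d" by (simp add: \<open>(2 * n) ^ d = 2 ^ d\<^sup>2\<close>[symmetric] power_mult_distrib)
    also have "\<dots> \<le> int (card B) * (int d * n\<^sup>2) * 2 ^ d"
      using B(3) by (intro mult_right_mono) auto
    also have "\<dots> \<le> int (card B) * (2 ^ d * (2 ^ d)\<^sup>2) * 2 ^ d"
    proof -
      have "int d \<le> 2 ^ d" by (metis less_exp less_imp_le of_nat_le_iff of_nat_numeral of_nat_power)
      moreover have "n\<^sup>2 \<le> (2 ^ d)\<^sup>2" unfolding n_def by (intro power_mono power_increasing) auto
      ultimately show ?thesis by (intro mult_right_mono mult_left_mono mult_mono) auto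
    qed
    also have "\<dots> = int (card B) * 2 ^ (4 * d)"
      by (simp add: power2_eq_square flip: power_add)
    finally have "int (2 ^ d\<^sup>2) \<le> int (card B * 2 ^ (4 * d))" by simp
    then show ?thesis by linarith
  qed
  then have "real (2 ^ d\<^sup>2) \<le> real (card B * 2 ^ (4 * d))" by (subst of_nat_le_iff)
  then have size: "2 ^ d\<^sup>2 \<le> real (card B) * 2 ^ (4 * d)" by simp
  have "real m \<le> real (2 ^ ((d + 1)\<^sup>2 + 1))" using upper by (subst of_nat_le_iff)
  also have "\<dots> = 2 ^ d\<^sup>2 * 2 ^ (2 * d + 2)" by (simp add: power2_eq_square flip: power_add)
  also have "\<dots> \<le> real (card B) * 2 ^ (4 * d) * 2 ^ (2 * d + 2)"
    using size by (intro mult_right_mono) auto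
  also have "\<dots> = real (card B) * 2 ^ (6 * d + 2)" by (simp flip: power_add)
  (* This step needs d \<ge> 1, which holds because m \<ge> 4. *)
  also have "\<dots> \<le> real (card B) * 2 ^ (8 * d)"
    using \<open>1 \<le> d\<close> by (intro mult_left_mono power_increasing) auto
  also have "(2::real) ^ (8 * d) = exp (8 * (d * ln 2))"
    by (simp add: exp_of_nat_mult[symmetric] flip: powr_realpow) (simp add: powr_def)
  also have "\<dots> \<le> exp (8 * sqrt (ln (real m)))"
  proof -
    have "d\<^sup>2 * ln 2 \<le> ln (real m)"
    proof -
      have "(2::nat) ^ d\<^sup>2 \<le> m" using \<open>P d\<close> unfolding P_def by simp
      then have "(2::real) ^ d\<^sup>2 \<le> real m" by (metis of_nat_le_iff of_nat_numeral of_nat_power)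
      then have "ln ((2::real) ^ d\<^sup>2) \<le> ln (real m)" by (intro ln_mono) auto
      then show ?thesis by (simp add: ln_realpow)
    qed
    moreover have "(d * ln 2)\<^sup>2 \<le> d\<^sup>2 * ln (2::real)"
    proof -
      have "(ln (2::real))\<^sup>2 \<le> ln 2"
        using ln_2_less_1 by (simp add: power2_eq_square mult_left_le)
      then show ?thesis by (simp add: power_mult_distrib mult_left_mono)
    qed
    ultimately have "d * ln 2 \<le> sqrt (ln (real m))" by (intro real_le_rsqrt) linarith
    then show ?thesis by simp
  qed
  finally have "real m \<le> real (card B) * exp (8 * sqrt (ln (real m)))"
    by (simp add: mult_left_mono)
  then have "real m * exp (- 8 * sqrt (ln (real m))) \<le> real (card B)"
    by (simp add: exp_minus field_simps)
  then show thesis using that[of B] B half by force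
qed

section \<open>The lower bound from the number of configurations\<close>

text \<open>With \<open>s = sqrt (ln m)\<close>, the Behrend loss \<open>exp (- 8 s)\<close> enters twice, once in \<open>card B\<close> and once in \<open>p\<close>
  (where the exponent \<open>1 / (N - 1)\<close> only helps), and the factor \<open>1 / 2\<close> left by the deletion costs at
  most \<open>exp (- s)\<close> because \<open>s \<ge> 1\<close> for \<open>m \<ge> 4\<close>. This explains \<open>17 = 8 + 8 + 1\<close>.\<close>

lemma g_lower_bound:
  assumes m: "m \<ge> 4" and t: "1 \<le> t" and few: "2 * card (configs m t) \<le> m ^ (k + 1)"
  shows "real m powr (1 - real k / (real (2 * t choose t) - 1) - 17 / sqrt (ln (real m))) \<le> real (g m t)"
proof -
  define s where "s = sqrt (ln (real m))"
  define b where "b = real (2 * t choose t) - 1"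
  have "1 \<le> ln (real m)"
  proof -
    have "exp (1::real) \<le> real m" using exp_le m by linarith
    then show ?thesis using m by (simp add: ln_ge_iff)
  qed
  then have s: "1 \<le> s" "s\<^sup>2 = ln (real m)" by (auto simp: s_def)
  have exp_s: "exp (s\<^sup>2) = real m" using s m by simp
  have N: "2 \<le> 2 * t choose t"
  proof -
    have "2 * t choose 1 \<le> 2 * t choose t" using t by (intro binomial_mono) auto
    then show ?thesis using t by simp
  qed
  have b: "1 \<le> b" "real ((2 * t choose t) - 1) = b"
  proof -
    have "2 \<le> real (2 * t choose t)" using N by (metis of_nat_le_iff of_nat_numeral)
    then show "1 \<le> b" by (simp add: b_def)
    have "1 \<le> 2 * t choose t" using N by linarith
    then show "real ((2 * t choose t) - 1) = b" by (simp only: b_def of_nat_diff of_nat_1)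
  qed
  obtain B where B: "B \<subseteq> {0..<int m}" "\<And>x. x \<in> B \<Longrightarrow> 2 * x < int m" "ap_free B"
    "real m * exp (- 8 * s) \<le> real (card B)"
    using behrend[OF m] unfolding s_def by blast
  have "exp (s\<^sup>2 - 8 * s) = real m * exp (- 8 * s)" by (simp add: exp_diff exp_minus exp_s field_simps)
  then have card_B: "exp (s\<^sup>2 - 8 * s) \<le> card B" using B(4) by simp
  then have "0 < real (card B)" using exp_gt_zero order.strict_trans2 by blast
  have "card B \<le> m" using card_mono[OF _ B(1)] by simp
  define x where "x = real (card B) / real m ^ (k + 1)"
  define p where "p = x powr (1 / b)"
  have x: "0 < x" "x \<le> 1"
  proof -
    have "real m ^ 1 \<le> real m ^ (k + 1)" using m by (intro power_increasing) auto
    then have "real (card B) \<le> real m ^ (k + 1)" using \<open>card B \<le> m\<close> by simp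
    then show "x \<le> 1" "0 < x" using m \<open>0 < real (card B)\<close> by (simp_all add: x_def)
  qed
  have "p \<le> 1 powr (1 / b)" unfolding p_def using x b by (intro powr_mono2) auto
  then have p: "0 < p" "p \<le> 1" using x by (simp_all add: p_def)
  have "p ^ ((2 * t choose t) - 1) = x"
    using x b p by (simp add: p_def powr_powr flip: powr_realpow)
  then have p_N: "p ^ (2 * t choose t) = p * x"
    using N by (metis One_nat_def Suc_1 Suc_le_D diff_Suc_1 power_Suc)
  have "p ^ (2 * t choose t) * card (configs m t) \<le> p * x * (real m ^ (k + 1) / 2)"
  proof -
    have "real (2 * card (configs m t)) \<le> real (m ^ (k + 1))" using few by (subst of_nat_le_iff)
    then have "card (configs m t) \<le> real m ^ (k + 1) / 2" by simp
    then show ?thesis unfolding p_N using p x by (intro mult_left_mono) auto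
  qed
  also have "\<dots> = p * card B / 2" using m by (simp add: x_def)
  finally have half: "p * card B / 2 \<le> g m t"
    using g_ge_deletion[OF _ t _ _ B(1-3), of p] m p by fastforce
  have "exp (- real k * s\<^sup>2 / b - 8 * s) \<le> p"
  proof -
    have pow: "real m ^ (k + 1) = exp (real k * s\<^sup>2 + s\<^sup>2)"
      by (simp add: exp_add exp_of_nat_mult exp_s)
    have "exp (- real k * s\<^sup>2 - 8 * s) = exp (s\<^sup>2 - 8 * s) / real m ^ (k + 1)"
      unfolding pow by (simp flip: exp_diff)
    also have "\<dots> \<le> x" unfolding x_def using card_B by (intro divide_right_mono) auto
    finally have "exp (- real k * s\<^sup>2 - 8 * s) powr (1 / b) \<le> p"
      unfolding p_def using b by (intro powr_mono2) auto
    moreover have "8 * s / b \<le> 8 * s" using b s by (simp add: divide_le_eq mult_le_cancel_left1)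
    then have "- real k * s\<^sup>2 / b - 8 * s \<le> (- real k * s\<^sup>2 - 8 * s) * (1 / b)"
      by (simp add: diff_divide_distrib)
    ultimately show ?thesis by (simp add: powr_def) (meson exp_le_cancel_iff order.trans)
  qed
  then have lower: "exp (- real k * s\<^sup>2 / b - 8 * s) * exp (s\<^sup>2 - 8 * s) \<le> p * card B"
    using card_B p by (intro mult_mono) auto
  have small: "exp (- s) \<le> 1 / 2"
  proof -
    have "2 \<le> exp s" using exp_ge_add_one_self[of s] s(1) by linarith
    then show ?thesis by (simp add: exp_minus field_simps)
  qed
  have "exp (- real k * s\<^sup>2 / b - 8 * s) * exp (s\<^sup>2 - 8 * s) * exp (- s) \<le> p * card B * (1 / 2)"
    by (rule mult_mono[OF lower small]) (use p in auto)
  moreover have "exp (- real k * s\<^sup>2 / b - 8 * s) * exp (s\<^sup>2 - 8 * s) * exp (- s)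
      = real m powr (1 - real k / b - 17 / s)"
  proof -
    have "real m powr (1 - real k / b - 17 / s) = exp ((1 - real k / b - 17 / s) * s\<^sup>2)"
      using m by (simp add: powr_def s(2))
    also have "(1 - real k / b - 17 / s) * s\<^sup>2 = - real k * s\<^sup>2 / b - 8 * s + (s\<^sup>2 - 8 * s) + - s"
      using s(1) by (simp add: field_simps power2_eq_square)
    finally show ?thesis by (simp only: exp_add)
  qed
  ultimately show ?thesis using half by (simp add: b_def s_def)
qed

section \<open>A weak form of Bertrand's postulate\<close>

text \<open>In Leibniz's harmonic triangle the entry \<open>1 / (k (n choose k))\<close> is, for \<open>k \<ge> 2\<close>, the difference of
  the entries at \<open>(n - 1, k - 1)\<close> and \<open>(n, k - 1)\<close>, and the first column is \<open>1 / n\<close>. By induction every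
  entry of row \<open>n\<close> is an integer combination of \<open>1 / 1, \<dots>, 1 / n\<close>, so it becomes an integer when
  multiplied by \<open>L\<close>.\<close>

lemma mult_binomial_dvd_common_multiple:
  fixes n k L :: nat
  assumes "1 \<le> k" "k \<le> n" and L: "\<And>j. 1 \<le> j \<Longrightarrow> j \<le> n \<Longrightarrow> j dvd L"
  shows "k * (n choose k) dvd L"
proof -
  have "real L / real (k * (n choose k)) \<in> \<int>"
    using assms
  proof (induction k arbitrary: n rule: nat_induct_at_least)
    case base
    then have "n dvd L" by simp
    then obtain c where "L = n * c" by (rule dvdE)
    then show ?case using base by simp
  next
    case (Suc k)
    obtain n' where n: "n = Suc n'" using Suc.prems by (cases n) auto
    let ?c = "real (n' choose k)"
    have absorb: "real (Suc k * (n choose Suc k)) = real n * ?c"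
      unfolding n by (metis Suc_times_binomial of_nat_mult)
    have "(n - k) * (n choose k) = n * (n' choose k)"
      using binomial_absorb_comp[of n k] by (simp add: n)
    then have "real (n - k) * real (n choose k) = real n * ?c" by (metis of_nat_mult)
    then have comp: "(real n - real k) * real (n choose k) = real n * ?c"
      using Suc.prems by (simp add: of_nat_diff)
    have nz: "?c \<noteq> 0" "real (n choose k) \<noteq> 0" "real k \<noteq> 0" "real n \<noteq> 0"
      using Suc by (auto simp: n)
    have inv: "1 / real (n choose k) = (real n - real k) / (real n * ?c)"
      using comp nz by (simp add: field_simps)
    have "real L / real (k * (n' choose k)) - real L / real (k * (n choose k))
        = real L / real k * (1 / ?c - 1 / real (n choose k))"
      by (simp add: right_diff_distrib)
    also have "\<dots> = real L / (real n * ?c)"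
      unfolding inv using nz by (simp add: field_simps)
    finally have "real L / real (Suc k * (n choose Suc k))
        = real L / real (k * (n' choose k)) - real L / real (k * (n choose k))"
      unfolding absorb by simp
    also have "\<dots> \<in> \<int>"
      using Suc.prems by (intro Ints_diff Suc.IH) (auto simp: n)
    finally show ?case .
  qed
  then obtain z where "real L / real (k * (n choose k)) = of_int z" by (auto elim: Ints_cases)
  then have "real L = of_int z * real (k * (n choose k))"
    using assms by (auto simp: field_simps)
  then have "int L = z * int (k * (n choose k))"
    by (metis of_int_eq_iff of_int_mult of_int_of_nat_eq)
  then have "int (k * (n choose k)) dvd int L" by simp
  then show ?thesis by (simp only: int_dvd_int_iff)
qed

text \<open>The number \<open>h * (2 * h choose h)\<close> divides \<open>L\<close>, and the central binomial coefficient is at least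
  \<open>4 ^ h / (2 * h)\<close>.\<close>

lemma four_power_le_common_multiple:
  fixes L :: nat
  assumes "1 \<le> h" "0 < L" and "\<And>j. 1 \<le> j \<Longrightarrow> j \<le> 2 * h \<Longrightarrow> j dvd L"
  shows "4 ^ h \<le> 2 * L"
proof -
  have "h * (2 * h choose h) \<le> L"
    using assms by (intro dvd_imp_le mult_binomial_dvd_common_multiple) auto
  moreover have "(4::real) ^ h \<le> real (2 * (h * (2 * h choose h)))"
    using central_binomial_lower_bound[of h] assms(1) by (simp add: field_simps)
  then have "real (4 ^ h) \<le> real (2 * (h * (2 * h choose h)))" by simp
  then have "4 ^ h \<le> 2 * (h * (2 * h choose h))" by (subst (asm) of_nat_le_iff)
  ultimately show ?thesis by linarith
qed

text \<open>The product of the largest powers \<open>p ^ e \<le> N\<close> of the primes is divisible by all \<open>j \<le> N\<close>; here \<open>e = 1\<close>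
  as soon as \<open>p\<^sup>2 > N\<close>.\<close>

lemma small_common_multiple:
  fixes N :: nat
  assumes "1 \<le> N"
  obtains L where "0 < L" "\<And>j. 1 \<le> j \<Longrightarrow> j \<le> N \<Longrightarrow> j dvd L"
    "L \<le> (\<Prod>p | prime p \<and> p \<le> N. if p\<^sup>2 \<le> N then N else p)"
proof -
  define e where "e p = (GREATEST e. p ^ e \<le> N)" for p
  define L where "L = (\<Prod>p | prime p \<and> p \<le> N. p ^ e p)"
  have bound: "i \<le> N" if "prime p" "p ^ i \<le> N" for p i
  proof -
    have "i < 2 ^ i" by simp
    also have "(2::nat) ^ i \<le> p ^ i" using prime_ge_2_nat[OF that(1)] by (intro power_mono) auto
    finally show ?thesis using that(2) by simp
  qed
  have e: "p ^ e p \<le> N" if "prime p" for p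
    unfolding e_def by (rule GreatestI_nat[where k = 0]) (use assms bound[OF that] in auto)
  have e_max: "i \<le> e p" if "prime p" "p ^ i \<le> N" for p i
    unfolding e_def by (rule Greatest_le_nat[where b = N]) (use that bound[OF that(1)] in auto)
  show thesis
  proof (rule that[of L])
    show "0 < L" by (auto simp: L_def intro!: prod_pos simp: prime_gt_0_nat)
    show "j dvd L" if "1 \<le> j" "j \<le> N" for j
    proof -
      have "j = (\<Prod>p\<in>prime_factors j. p ^ multiplicity p j)"
        using that by (simp add: prime_factorization_nat)
      also have "\<dots> dvd (\<Prod>p\<in>prime_factors j. p ^ e p)"
      proof (intro prod_dvd_prod le_imp_power_dvd)
        fix p assume p: "p \<in> prime_factors j"
        have "p ^ multiplicity p j \<le> j"
          using that by (intro dvd_imp_le multiplicity_dvd) auto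
        then show "multiplicity p j \<le> e p"
          using p that by (intro e_max) auto
      qed
      also have "\<dots> dvd L" unfolding L_def
      proof (rule prod_dvd_prod_subset)
        show "prime_factors j \<subseteq> {p. prime p \<and> p \<le> N}"
          using that by (auto dest: dvd_imp_le simp: prime_factors_dvd)
      qed simp
      finally show ?thesis .
    qed
    have "p ^ e p \<le> (if p\<^sup>2 \<le> N then N else p)" if "prime p" for p
    proof (cases "p\<^sup>2 \<le> N")
      case False
      have "e p \<le> 1"
      proof (rule ccontr)
        assume "\<not> e p \<le> 1"
        then have "p\<^sup>2 \<le> p ^ e p"
          using prime_gt_0_nat[OF that] by (intro power_increasing) auto
        then show False using e[OF that] False by simp
      qed
      then have "p ^ e p \<le> p ^ 1" using prime_gt_0_nat[OF that] by (intro power_increasing) auto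
      then show ?thesis using False by simp
    qed (use e[OF that] in simp)
    then show "L \<le> (\<Prod>p | prime p \<and> p \<le> N. if p\<^sup>2 \<le> N then N else p)"
      unfolding L_def by (intro prod_mono) auto
  qed
qed

lemma prod_primes_dvd:
  fixes n :: nat
  assumes "finite P" "\<And>p. p \<in> P \<Longrightarrow> prime p" "\<And>p. p \<in> P \<Longrightarrow> p dvd n"
  shows "\<Prod>P dvd n"
  using assms
proof (induction P rule: finite_induct)
  case (insert p P)
  have "coprime p (\<Prod>P)"
    using insert by (intro prod_coprime_right) (auto intro!: primes_coprime)
  then show ?case using insert by (simp add: divides_mult)
qed simp

lemma binomial_middle_odd_le: "(2 * k + 1) choose k \<le> 4 ^ k"
proof -
  have "2 * ((2 * k + 1) choose k) = ((2 * k + 1) choose k) + ((2 * k + 1) choose (k + 1))"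
    using binomial_symmetric[of k "2 * k + 1"] by simp
  also have "\<dots> = (\<Sum>i\<in>{k, k + 1}. (2 * k + 1) choose i)" by simp
  also have "\<dots> \<le> (\<Sum>i\<le>2 * k + 1. (2 * k + 1) choose i)" by (intro sum_mono2) auto
  also have "\<dots> = 2 * 4 ^ k" by (simp only: choose_row_sum) (simp add: power_mult)
  finally show ?thesis by simp
qed

text \<open>For odd \<open>n = 2 k + 1\<close> every prime in \<open>{k + 2..n}\<close> divides \<open>n choose k\<close>, which is at most \<open>4 ^ k\<close>.
  An even \<open>n > 2\<close> contributes no prime.\<close>

lemma primorial_le: "\<Prod>{p::nat. prime p \<and> p \<le> n} \<le> 4 ^ n"
proof (induction n rule: less_induct)
  case (less n)
  consider "n \<le> 1" | "n = 2" | "n > 2" "even n" | "odd n" "n > 2" by linarith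
  then show ?case
  proof cases
    case 1
    have "\<not> (prime p \<and> p \<le> n)" for p :: nat
      using 1 prime_ge_2_nat[of p] by linarith
    then have none: "{p::nat. prime p \<and> p \<le> n} = {}" by blast
    show ?thesis unfolding none by simp
  next
    case 2
    have "prime p \<and> p \<le> n \<longleftrightarrow> p = 2" for p :: nat
      using 2 prime_ge_2_nat[of p] two_is_prime_nat by (cases "p = 2") auto
    then have "{p::nat. prime p \<and> p \<le> n} = {2}" by blast
    then show ?thesis using 2 by simp
  next
    case 3
    then have "\<not> prime n" using prime_odd_nat by blast
    then have "{p::nat. prime p \<and> p \<le> n} = {p. prime p \<and> p \<le> n - 1}"
      by (intro Collect_cong conj_cong refl) (use 3 in \<open>force simp: le_less\<close>)
    then have "\<Prod>{p::nat. prime p \<and> p \<le> n} \<le> 4 ^ (n - 1)" using less[of "n - 1"] 3 by simp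
    also have "\<dots> \<le> 4 ^ n" by (intro power_increasing) auto
    finally show ?thesis .
  next
    case 4
    then obtain k where n: "n = 2 * k + 1" by (elim oddE)
    have "1 \<le> k" using 4 n by simp
    let ?Q = "{p::nat. prime p \<and> k + 1 < p \<and> p \<le> n}"
    have "p dvd n choose k" if "p \<in> ?Q" for p
    proof -
      have p: "prime p" "k + 1 < p" "p \<le> n" using that by auto
      have "fact k * fact (n - k) * (n choose k) = (fact n :: nat)"
        using n by (intro binomial_fact_lemma) simp
      moreover have "p dvd fact n" using p by (simp add: prime_dvd_fact_iff)
      moreover have "\<not> p dvd fact k" "\<not> p dvd fact (n - k)"
        using p n by (simp_all add: prime_dvd_fact_iff del: fact_Suc)
      ultimately show ?thesis using p(1) by (metis prime_dvd_mult_iff)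
    qed
    then have "\<Prod>?Q dvd n choose k" by (intro prod_primes_dvd) auto
    then have "\<Prod>?Q \<le> n choose k" using n by (intro dvd_imp_le) auto
    also have "\<dots> \<le> 4 ^ k" using binomial_middle_odd_le[of k] n by simp
    finally have Q: "\<Prod>?Q \<le> 4 ^ k" .
    have "{p::nat. prime p \<and> p \<le> n} = {p. prime p \<and> p \<le> k + 1} \<union> ?Q"
      using n by auto
    then have "\<Prod>{p::nat. prime p \<and> p \<le> n} = \<Prod>{p. prime p \<and> p \<le> k + 1} * \<Prod>?Q"
      by (simp add: prod.union_disjoint disjoint_iff)
    also have "\<dots> \<le> 4 ^ (k + 1) * 4 ^ k"
      using Q less[of "k + 1"] \<open>1 \<le> k\<close> n by (intro mult_mono) auto
    also have "\<dots> = 4 ^ n" by (simp add: n flip: power_add)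
    finally show ?thesis .
  qed
qed

lemma two_add_le_two_power:
  "6 \<le> a \<Longrightarrow> a + 2 \<le> 2 ^ (a - 3)" for a :: nat
proof (induction a rule: nat_induct_at_least)
  case (Suc a)
  have "Suc a - 3 = Suc (a - 3)" using Suc by simp
  then have "(2::nat) ^ (Suc a - 3) = 2 * 2 ^ (a - 3)" by (simp only: power_Suc)
  then show ?case using Suc by linarith
qed simp

text \<open>Let \<open>h = n div 2\<close>. A common multiple \<open>L\<close> of \<open>1, \<dots>, 2h\<close> is at least \<open>4 ^ h / 2\<close>. If there were no
  prime in the interval, the small common multiple would be at most \<open>n ^ s\<close>, from the \<open>s\<close> primes
  with \<open>p\<^sup>2 \<le> n\<close>, times the product of the primes up to \<open>n / 4\<close>, which is at most \<open>2 ^ h\<close>. Hence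
  \<open>2 ^ h \<le> 2 n ^ s\<close>. For \<open>4 ^ a \<le> n < 4 ^ (a + 1)\<close> the left exponent is at least \<open>2 ^ (2 a - 1)\<close>, while
  \<open>s \<le> 2 ^ (a + 1)\<close> keeps the right one below \<open>(a + 2) 2 ^ (a + 2)\<close>: a contradiction once \<open>a \<ge> 6\<close>.\<close>

lemma weak_bertrand_large:
  fixes n :: nat
  assumes "4096 \<le> n"
  shows "\<exists>p. prime p \<and> p \<le> n \<and> n < 4 * p"
proof (rule ccontr)
  assume "\<not> ?thesis"
  then have gap: "4 * p \<le> n" if "prime p" "p \<le> n" for p using that by (meson not_le)
  define h where "h = n div 2"
  define S where "S = {p::nat. prime p \<and> p\<^sup>2 \<le> n}"
  have "1 \<le> 2 * h" "1 \<le> h" "2 * h \<le> n" using assms by (auto simp: h_def)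
  obtain L where L: "0 < L" "\<And>j. 1 \<le> j \<Longrightarrow> j \<le> 2 * h \<Longrightarrow> j dvd L"
    "L \<le> (\<Prod>p | prime p \<and> p \<le> 2 * h. if p\<^sup>2 \<le> 2 * h then 2 * h else p)"
    using small_common_multiple[OF \<open>1 \<le> 2 * h\<close>] by blast
  have le_sq: "p \<le> n" if "p\<^sup>2 \<le> n" for p 
    using that le_square[of p] unfolding power2_eq_square by (rule order.trans[rotated])
  have "S \<subseteq> {..n}" unfolding S_def using le_sq by blast
  then have finS: "finite S" by (rule finite_subset) simp
  have "(if p\<^sup>2 \<le> 2 * h then 2 * h else p) \<le> (if p \<in> S then n else 1) * p" if "prime p" for p
  proof (cases "p\<^sup>2 \<le> 2 * h")
    case True
    then have "p \<in> S" using that \<open>2 * h \<le> n\<close> by (simp add: S_def)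
    then show ?thesis
      using True \<open>2 * h \<le> n\<close> prime_gt_0_nat[OF that] mult_le_mono[of "2 * h" n 1 p] by simp
  qed (use assms in auto)
  then have "L \<le> (\<Prod>p | prime p \<and> p \<le> 2 * h. (if p \<in> S then n else 1) * p)"
    by (intro order.trans[OF L(3)] prod_mono) auto
  also have "\<dots> = (\<Prod>p | prime p \<and> p \<le> 2 * h. if p \<in> S then n else 1) * \<Prod>{p. prime p \<and> p \<le> 2 * h}"
    by (rule prod.distrib)
  also have "\<dots> \<le> n ^ card S * 4 ^ (n div 4)"
  proof (rule mult_mono)
    have "(\<Prod>p | prime p \<and> p \<le> 2 * h. if p \<in> S then n else 1) = n ^ card ({p. prime p \<and> p \<le> 2 * h} \<inter> S)"
      by (simp add: prod.If_cases)
    also have "\<dots> \<le> n ^ card S"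
      using assms finS by (intro power_increasing card_mono) auto
    finally show "(\<Prod>p | prime p \<and> p \<le> 2 * h. if p \<in> S then n else 1) \<le> n ^ card S" .
    have "p \<le> n div 4" if "prime p" "p \<le> 2 * h" for p
      using gap[of p] that \<open>2 * h \<le> n\<close> by linarith
    then have "{p. prime p \<and> p \<le> 2 * h} \<subseteq> {p. prime p \<and> p \<le> n div 4}" by blast
    then have "\<Prod>{p. prime p \<and> p \<le> 2 * h} \<le> \<Prod>{p. prime p \<and> p \<le> n div 4}"
      by (intro dvd_imp_le prod_dvd_prod_subset prod_pos) (auto intro: prime_gt_0_nat)
    also have "\<dots> \<le> 4 ^ (n div 4)" by (rule primorial_le)
    finally show "\<Prod>{p. prime p \<and> p \<le> 2 * h} \<le> 4 ^ (n div 4)" .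
  qed auto
  also have "(4::nat) ^ (n div 4) \<le> 2 ^ h"
  proof -
    have "(4::nat) ^ (n div 4) = 2 ^ (2 * (n div 4))" by (simp add: power_mult)
    also have "\<dots> \<le> 2 ^ h" by (intro power_increasing) (auto simp: h_def)
    finally show ?thesis .
  qed
  finally have L_upper: "L \<le> n ^ card S * 2 ^ h" by simp
  have "4 ^ h \<le> 2 * L" using four_power_le_common_multiple[OF \<open>1 \<le> h\<close> L(1,2)] .
  also have "\<dots> \<le> 2 * (n ^ card S * 2 ^ h)" using L_upper by simp
  finally have "2 ^ h * 2 ^ h \<le> (2 * n ^ card S) * 2 ^ h"
    by (simp flip: power_mult_distrib)
  then have main: "2 ^ h \<le> 2 * n ^ card S" by simp
  obtain a where a: "4 ^ a \<le> n" "n < 4 ^ (a + 1)"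
    using ex_power_ivl1[of 4 n] assms by auto
  have "6 \<le> a"
  proof (rule ccontr)
    assume "\<not> 6 \<le> a"
    then have "(4::nat) ^ (a + 1) \<le> 4 ^ 6" by (intro power_increasing) auto
    then show False using a assms by simp
  qed
  have "card S \<le> 2 ^ (a + 1)"
  proof -
    have "S \<subseteq> {1..2 ^ (a + 1)}"
    proof
      fix p assume "p \<in> S"
      then have p: "prime p" "p\<^sup>2 \<le> n" by (auto simp: S_def)
      have "(4::nat) ^ (a + 1) = (2 ^ (a + 1))\<^sup>2"
        by (simp add: power2_eq_square flip: power_mult_distrib)
      then have "p\<^sup>2 < (2 ^ (a + 1))\<^sup>2" using p(2) a(2) by linarith
      then have "p < 2 ^ (a + 1)" by (rule power_less_imp_less_base) simp
      then show "p \<in> {1..2 ^ (a + 1)}" using prime_gt_0_nat[OF p(1)] by simp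
    qed
    then show ?thesis using card_mono[of "{1..2 ^ (a + 1)}" S] by simp
  qed
  have "n ^ card S \<le> (4 ^ (a + 1)) ^ card S" using a by (intro power_mono) auto
  also have "\<dots> \<le> (4 ^ (a + 1)) ^ (2 ^ (a + 1))"
    using \<open>card S \<le> 2 ^ (a + 1)\<close> by (intro power_increasing) auto
  also have "\<dots> = (2::nat) ^ (2 * (a + 1) * 2 ^ (a + 1))"
    unfolding power_mult by simp
  also have "2 * (a + 1) * 2 ^ (a + 1) = (a + 1) * 2 ^ (a + 2)" by simp
  finally have "2 * n ^ card S \<le> 2 ^ (1 + (a + 1) * 2 ^ (a + 2))" by simp
  with main have "(2::nat) ^ h \<le> 2 ^ (1 + (a + 1) * 2 ^ (a + 2))" by linarith
  then have "h \<le> 1 + (a + 1) * 2 ^ (a + 2)" by (simp only: power_increasing_iff one_less_numeral_iff semiring_norm)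
  also have "\<dots> < (a + 2) * 2 ^ (a + 2)"
  proof -
    have "(1::nat) < 2 ^ (a + 2)" by (rule one_less_power) auto
    then show ?thesis unfolding distrib_right by linarith
  qed
  also have "\<dots> \<le> 2 ^ (a - 3) * 2 ^ (a + 2)"
    using two_add_le_two_power[OF \<open>6 \<le> a\<close>] by (intro mult_right_mono) auto
  also have "\<dots> = 2 ^ (2 * a - 1)" 
  proof -
    have "(a - 3) + (a + 2) = 2 * a - 1" using \<open>6 \<le> a\<close> by simp
    then show ?thesis by (metis power_add)
  qed
  also have "\<dots> \<le> h"
  proof -
    have "Suc (2 * a - 1) = 2 * a" using \<open>6 \<le> a\<close> by simp
    then have "2 * 2 ^ (2 * a - 1) = (2::nat) ^ (2 * a)" by (metis power_Suc)
    also have "\<dots> = 4 ^ a" by (simp add: power_mult)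
    finally show ?thesis using a unfolding h_def by linarith
  qed
  finally show False by simp
qed

lemma prime_by_trial_division:
  fixes n k :: nat
  assumes "1 < n" "n < (k + 1)\<^sup>2" "\<forall>d\<in>set [2..<k + 1]. \<not> d dvd n"
  shows "prime n"
  unfolding prime_nat_iff
proof (intro conjI allI impI)
  fix m assume "m dvd n"
  then obtain c where n: "n = m * c" by (rule dvdE)
  have big: "k + 1 \<le> d" if "d dvd n" "d \<noteq> 1" "d \<noteq> 0" for d
    using assms(3) that by (cases "d \<le> k") auto
  show "m = 1 \<or> m = n"
  proof (rule ccontr)
    assume "\<not> (m = 1 \<or> m = n)"
    moreover have "0 < m * c" using assms(1) n by linarith
    then have "m \<noteq> 0" "c \<noteq> 0" by simp_all
    ultimately have "k + 1 \<le> m" "k + 1 \<le> c" using big[of m] big[of c] n by auto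
    then have "(k + 1)\<^sup>2 \<le> n" unfolding n power2_eq_square by (rule mult_le_mono)
    then show False using assms(2) by simp
  qed
qed (fact assms(1))

lemma weak_bertrand:
  fixes n :: nat
  assumes "3 \<le> n"
  obtains p where "prime p" "odd p" "p \<le> n" "n < 4 * p"
proof (cases "4096 \<le> n")
  case True
  then obtain p where p: "prime p" "p \<le> n" "n < 4 * p" using weak_bertrand_large by blast
  moreover have "odd p" using p True by (intro prime_odd_nat) auto
  ultimately show thesis using that by blast
next
  case False
  (* A chain of primes, each less than four times its predecessor, that reaches 4096. *)
  have primes: "prime (3::nat)" "prime (11::nat)" "prime (43::nat)" by simp_all
  have prime167: "prime (167::nat)" by (rule prime_by_trial_division[of _ 12]) simp_all
  have prime661: "prime (661::nat)" by (rule prime_by_trial_division[of _ 25]) simp_all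
  have prime2633: "prime (2633::nat)" by (rule prime_by_trial_division[of _ 51]) simp_all
  consider "n < 12" | "11 \<le> n" "n < 44" | "43 \<le> n" "n < 172" | "167 \<le> n" "n < 668"
    | "661 \<le> n" "n < 2644" | "2633 \<le> n" using assms by linarith
  then show thesis
  proof cases
    case 1 then show thesis using assms by (intro that[OF primes(1)]) simp_all
  next
    case 2 then show thesis by (intro that[OF primes(2)]) simp_all
  next
    case 3 then show thesis by (intro that[OF primes(3)]) simp_all
  next
    case 4 then show thesis by (intro that[OF prime167]) simp_all
  next
    case 5 then show thesis by (intro that[OF prime661]) simp_all
  next
    case 6 then show thesis using False by (intro that[OF prime2633]) simp_all
  qed
qed

section \<open>Sidon sets and sums of two elements\<close>

definition sidon :: "int set \<Rightarrow> bool" where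
  "sidon R \<longleftrightarrow> (\<forall>a\<in>R. \<forall>b\<in>R. \<forall>c\<in>R. \<forall>d\<in>R. a + b = c + d \<longrightarrow> a = c \<or> a = d)"

text \<open>The number \<open>2 p k + (k\<^sup>2 mod p)\<close> encodes the point \<open>(k, k\<^sup>2)\<close> of the parabola modulo \<open>p\<close>, with room
  for one addition in the low digit. If the codes of \<open>a, b\<close> and of \<open>c, d\<close> have the same sum, then
  \<open>a + b = c + d\<close> and \<open>a\<^sup>2 + b\<^sup>2 \<equiv> c\<^sup>2 + d\<^sup>2\<close>, hence \<open>2 (a - c) (a - d) \<equiv> 0\<close> modulo \<open>p\<close>.\<close>

lemma erdos_turan_sidon:
  assumes "prime p" "odd p"
  obtains R where "R \<subseteq> {0..<2 * (int p)\<^sup>2}" "card R = p" "sidon R"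
proof -
  define q where "q = int p"
  have q: "1 < q" using assms(1) prime_gt_1_nat by (simp add: q_def)
  have residue: "0 \<le> z mod q \<and> z mod q < q" for z using q by simp
  define f where "f k = (2 * q) * k + k\<^sup>2 mod q" for k
  have f: "f k div (2 * q) = k \<and> f k mod (2 * q) = k\<^sup>2 mod q" for k
  proof -
    have "0 \<le> k\<^sup>2 mod q" "k\<^sup>2 mod q < 2 * q"
      using residue[of "k\<^sup>2"] by linarith+
    then show ?thesis using q by (simp add: f_def)
  qed
  have decode: "a + b = c + d \<and> (a\<^sup>2 mod q + b\<^sup>2 mod q) = (c\<^sup>2 mod q + d\<^sup>2 mod q)"
    if "f a + f b = f c + f d" for a b c d
  proof -
    have split: "(f x + f y) div (2 * q) = x + y \<and> (f x + f y) mod (2 * q) = x\<^sup>2 mod q + y\<^sup>2 mod q" for x y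
    proof -
      have *: "0 \<le> x\<^sup>2 mod q + y\<^sup>2 mod q" "x\<^sup>2 mod q + y\<^sup>2 mod q < 2 * q"
        using residue[of "x\<^sup>2"] residue[of "y\<^sup>2"] by linarith+
      have "f x + f y = (2 * q) * (x + y) + (x\<^sup>2 mod q + y\<^sup>2 mod q)"
        by (simp add: f_def algebra_simps)
      then show ?thesis using * q by simp
    qed
    show ?thesis using split[of a b] split[of c d] that by simp
  qed
  have inj: "inj_on f {0..<q}" using f by (metis inj_onI)
  have sid: "a = c \<or> a = d"
    if abcd: "a \<in> {0..<q}" "b \<in> {0..<q}" "c \<in> {0..<q}" "d \<in> {0..<q}" and eq: "f a + f b = f c + f d"
    for a b c d
  proof -
    have sum: "a + b = c + d" using decode[OF eq] by simp
    have sq: "(a\<^sup>2 + b\<^sup>2) mod q = (c\<^sup>2 + d\<^sup>2) mod q"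
      using decode[OF eq] by (metis mod_add_eq)
    have b: "b = c + d - a" using sum by simp
    have "q dvd a\<^sup>2 + b\<^sup>2 - (c\<^sup>2 + d\<^sup>2)" using sq by (simp add: mod_eq_dvd_iff)
    also have "a\<^sup>2 + b\<^sup>2 - (c\<^sup>2 + d\<^sup>2) = 2 * ((a - c) * (a - d))"
      by (simp add: b power2_eq_square algebra_simps)
    finally have dvd: "q dvd 2 * ((a - c) * (a - d))" .
    have "prime q" using assms(1) by (simp add: q_def)
    moreover have "\<not> q dvd 2"
    proof -
      have "p \<noteq> 2" using assms(2) by auto
      then have "2 < q" using q by (simp add: q_def)
      then show ?thesis using zdvd_imp_le[of q 2] by auto
    qed
    ultimately have "q dvd a - c \<or> q dvd a - d" using dvd by (simp add: prime_dvd_mult_iff)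
    then have "a mod q = c mod q \<or> a mod q = d mod q" by (simp add: mod_eq_dvd_iff)
    then show ?thesis using abcd by simp
  qed
  show thesis
  proof (rule that[of "f ` {0..<q}"])
    show "card (f ` {0..<q}) = p" using card_image[OF inj] by (simp add: q_def)
    show "sidon (f ` {0..<q})" unfolding sidon_def using sid by blast
    show "f ` {0..<q} \<subseteq> {0..<2 * (int p)\<^sup>2}"
    proof (rule image_subsetI)
      fix k assume k: "k \<in> {0..<q}"
      have r: "0 \<le> k\<^sup>2 mod q" "k\<^sup>2 mod q < q" using q by auto
      have "(2 * q) * (k + 1) \<le> (2 * q) * q" using k q by (intro mult_left_mono) auto
      moreover have "f k < (2 * q) * (k + 1)" 
        unfolding f_def distrib_left using r q by linarith
      ultimately have "f k < 2 * q\<^sup>2" by (simp add: power2_eq_square)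
      moreover have "0 \<le> f k" using r q k by (simp add: f_def)
      ultimately show "f k \<in> {0..<2 * (int p)\<^sup>2}" by (simp add: q_def)
    qed
  qed
qed

text \<open>The pairs of sums \<open>a + b, c + d\<close> and \<open>a + c, b + d\<close> have the same total. In a Sidon set the pairs
  would have to agree, which means \<open>b = c\<close> or \<open>a = d\<close>.\<close>

lemma avoiding_of_sidon:
  assumes m: "m > 1" and R: "R \<subseteq> {0..<int m}" "\<And>x. x \<in> R \<Longrightarrow> 2 * x < int m" "sidon R"
  shows "avoiding m 2 R"
  unfolding avoiding_iff[OF m]
proof (intro conjI ballI allI impI notI)
  fix x\<^sub>0 X assume X: "X \<subseteq> {0..<int m}" "card X = 2 * 2" and sub: "sum_config m 2 x\<^sub>0 X \<subseteq> R"
  obtain a b c d where abcd: "X = {a, b, c, d}" "distinct [a, b, c, d]"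
  proof -
    have "card X = 4" using X(2) by simp
    then obtain xs where "set xs = X" "distinct xs" "length xs = 4"
      by (metis X(1) distinct_card finite_atLeastLessThan_int finite_distinct_list finite_subset)
    then show thesis using that by (auto simp: numeral_eq_Suc length_Suc_conv)
  qed
  define s where "s u v = (x\<^sub>0 + (u + v)) mod int m" for u v
  have mem: "s u v \<in> R" if "u \<in> X" "v \<in> X" "u \<noteq> v" for u v
  proof -
    have "s u v = (x\<^sub>0 + \<Sum>{u, v}) mod int m" using that by (simp add: s_def)
    moreover have "{u, v} \<subseteq> X \<and> card {u, v} = 2" using that by simp
    ultimately show ?thesis using sub unfolding sum_config_def by blast
  qed
  have in_R: "s a b \<in> R" "s c d \<in> R" "s a c \<in> R" "s b d \<in> R"
    using abcd by (auto intro: mem)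
  have "(s a b + s c d) mod int m = (s a c + s b d) mod int m"
    unfolding s_def mod_add_eq by (simp add: algebra_simps)
  then have "s a b + s c d = s a c + s b d"
    using in_R R by (intro half_interval_sums_eq[of _ "int m"]) auto
  then have "s a b = s a c \<or> s a b = s b d"
    using in_R R(3) unfolding sidon_def by blast
  then have "int m dvd b - c \<or> int m dvd a - d"
    by (auto simp: s_def mod_eq_dvd_iff algebra_simps)
  then have "b mod int m = c mod int m \<or> a mod int m = d mod int m"
    by (simp add: mod_eq_dvd_iff)
  moreover have "{a, b, c, d} \<subseteq> {0..<int m}" using X(1) abcd(1) by simp
  ultimately show False using abcd(2) by auto
qed (use R in auto)

lemma g_two_lower_bound:
  assumes "m \<ge> 64"
  shows "sqrt (real m) / 8 \<le> real (g m 2)"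
proof -
  (* p \<le> n gives 4 p^2 \<le> m, and n < 4 p gives sqrt m / 8 \<le> p. *)
  define n where "n = nat \<lfloor>sqrt (real m) / 2\<rfloor>"
  have "8 \<le> sqrt (real m)" using assms by (intro real_le_rsqrt) auto
  then have n: "real n \<le> sqrt (real m) / 2" "sqrt (real m) / 2 < real n + 1" "3 \<le> n"
    unfolding n_def by (linarith, linarith, simp add: le_nat_iff le_floor_iff)
  obtain p where p: "prime p" "odd p" "p \<le> n" "n < 4 * p"
    using weak_bertrand[OF n(3)] by blast
  obtain R where R: "R \<subseteq> {0..<2 * (int p)\<^sup>2}" "card R = p" "sidon R"
    using erdos_turan_sidon[OF p(1,2)] by blast
  have "4 * (real p)\<^sup>2 \<le> real m"
  proof -
    have "2 * real p \<le> sqrt (real m)" using n p by simp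
    then have "(2 * real p)\<^sup>2 \<le> (sqrt (real m))\<^sup>2" by (intro power_mono) auto
    then show ?thesis by (simp add: power_mult_distrib)
  qed
  then have "real (4 * p\<^sup>2) \<le> real m" by simp
  then have "4 * p\<^sup>2 \<le> m" by (subst (asm) of_nat_le_iff)
  then have pm: "4 * (int p)\<^sup>2 \<le> int m" by (metis of_nat_le_iff of_nat_mult of_nat_numeral of_nat_power)
  have "avoiding m 2 R"
  proof (rule avoiding_of_sidon)
    show "R \<subseteq> {0..<int m}" "\<And>x. x \<in> R \<Longrightarrow> 2 * x < int m"
      using R(1) pm by fastforce+
  qed (use assms R in auto)
  then have "p \<le> g m 2" using g_ge_card R(2) by blast
  moreover have "real n + 1 \<le> 4 * real p" using p(4) by linarith
  ultimately show ?thesis using n by linarith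
qed

section \<open>The bounds together\<close>

theorem theorem1p8:
  shows "(\<exists>C::real. C > 0 \<and>
           (\<forall>t m :: nat. t \<ge> 3 \<longrightarrow> m \<ge> 4 \<longrightarrow> m \<ge> 2 * t \<longrightarrow>
              real (g m t) \<ge>
                real m powr (1 - 2 * real t / (real ((2 * t) choose t) - 1) - C / sqrt (ln (real m))) \<and>
              (prime m \<longrightarrow>
                 real (g m t) \<ge>
                   real m powr (1 - (2 * real t - 1) / (real ((2 * t) choose t) - 1) - C / sqrt (ln (real m)))))) \<and>
         (\<forall>m::nat. m \<ge> 64 \<longrightarrow> real (g m 2) \<ge> sqrt (real m) / 8)"
proof (intro conjI exI[of _ "17::real"] allI impI)
  fix t m :: nat assume "3 \<le> t" "4 \<le> m" "2 * t \<le> m"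
  then show "real m powr (1 - 2 * real t / (real ((2 * t) choose t) - 1) - 17 / sqrt (ln (real m))) \<le> real (g m t)"
    using g_lower_bound[of m t "2 * t"] card_configs_le[of t m] by simp
  assume "prime m"
  then show "real m powr (1 - (2 * real t - 1) / (real ((2 * t) choose t) - 1) - 17 / sqrt (ln (real m))) \<le> real (g m t)"
    using g_lower_bound[of m t "2 * t - 1"] card_configs_prime_le[of m t] \<open>3 \<le> t\<close> \<open>4 \<le> m\<close> \<open>2 * t \<le> m\<close>
    by (simp add: of_nat_diff)
qed (use g_two_lower_bound in auto)

end
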